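(* For every $l\in\mathbb N$, the polynomial $P_l(u,v)\in\mathbb C[u,v]$ defined by $\det(H_l+\lambda\,\mathrm{Id})=P_l(\lambda,\mu^2)$ is irreducible.
   Context: For $l\in\mathbb N$ and $\mu\in\mathbb C$, $H_l$ is the tridiagonal $l\times l$ matrix with entries $H_{l;jj}=(1-j)(l-j+1)$, $H_{l;j,j+1}=\mu j$, $H_{l;j,j-1}=\mu(l-j+1)$, and $H_{l;ij}=0$ if $|i-j|\geq 2$. It is known that $\det(H_l+\lambda\,\mathrm{Id})$ is a polynomial of degree $l$ in the variables $(u,v)=(\lambda,\mu^2)$; this polynomial is denoted $P_l(u,v)$. *)

theory Defs
  imports "Jordan_Normal_Form.Determinant" "HOL-Computational_Algebra.Polynomial_Factorial"
begin

text \<open>The tridiagonal l x l matrix H_l (paper indices j = 1..l correspond to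
  Isabelle row index i = j - 1).\<close>
definition H_mat :: "nat \<Rightarrow> complex \<Rightarrow> complex mat" where
  "H_mat l \<mu> = mat l l (\<lambda>(i, k).
     let j = i + 1 in
     if k = i then (1 - of_nat j) * (of_nat l - of_nat j + 1)
     else if k = i + 1 then \<mu> * of_nat j
     else if k + 1 = i then \<mu> * (of_nat l - of_nat j + 1)
     else 0)"

text \<open>Bivariate polynomials C[u,v] are represented as C[v][u], i.e. the type
  complex poly poly (outer variable u, coefficients are polynomials in v).
  Evaluation at (u,v):\<close>
definition eval2 :: "complex poly poly \<Rightarrow> complex \<Rightarrow> complex \<Rightarrow> complex" where
  "eval2 P u v = poly (map_poly (\<lambda>c. poly c v) P) u"

definition is_P :: "nat \<Rightarrow> complex poly poly \<Rightarrow> bool" where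
  "is_P l P \<longleftrightarrow> (\<forall>lam \<mu>. det (H_mat l \<mu> + lam \<cdot>\<^sub>m 1\<^sub>m l) = eval2 P lam (\<mu>^2))"

end

theory Submission
  imports Defs "HOL-Computational_Algebra.Fundamental_Theorem_Algebra"
    "HOL-Computational_Algebra.Field_as_Ring"
begin

text \<open>
  Write \<open>a\<^sub>k = k (l - k)\<close>. Expanding the tridiagonal determinant shows that \<open>P\<close> is the last term of
  \<open>E\<^sub>k\<^sub>+\<^sub>1 = (u - a\<^sub>k) E\<^sub>k - v a\<^sub>k E\<^sub>k\<^sub>-\<^sub>1\<close>, so \<open>P(u, 0)\<close> is the product of the \<open>u - a\<^sub>k\<close>, \<open>k < l\<close>.

  Suppose \<open>P = Q R\<close> and let \<open>Q\<^sub>0\<close>, \<open>Q\<^sub>1\<close> be the coefficients of \<open>1\<close> and \<open>v\<close> in \<open>Q\<close>. Giving \<open>u\<close> weight 1 and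
  \<open>v\<close> weight 2, \<open>P\<close> has weight \<open>l\<close>, which forces \<open>deg Q\<^sub>1 \<le> deg Q\<^sub>0 - 2\<close>; hence the residues of
  \<open>Q\<^sub>1 / Q\<^sub>0\<close> add up to 0. (Equivalently, the sum of the roots \<open>u\<close> of \<open>Q\<close> does not depend on \<open>v\<close>.)

  The residues are minus the first-order displacements of the roots in \<open>v\<close>, and are read off from
  the lowest coefficient of \<open>P(x + e v, v)\<close> in \<open>v\<close> at \<open>x = a\<^sub>k\<close>. Away from the largest value
  \<open>a\<^sub>k\<close>, \<open>k = l div 2\<close>, the residues are positive rational numbers, except possibly at
  \<open>k = l/2 - 1\<close>, where the residue of a factor may be irrational. In both cases the sum cannot
  vanish, so the largest \<open>a\<^sub>k\<close> is a root of \<open>Q\<^sub>0\<close> for every nonconstant factor \<open>Q\<close>. If there were two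
  such factors, the gradient of \<open>P\<close> would vanish at that point of \<open>v = 0\<close>, but it does not.
\<close>

section \<open>Tridiagonal determinants and the recursion for \<open>P\<close>\<close>

text \<open>Laplace expansion along the last row leaves two minors; the off-diagonal one has a
  single nonzero entry in its last column, so a second expansion finishes.\<close>

lemma det_tridiagonal:
  fixes f :: "nat \<Rightarrow> nat \<Rightarrow> 'a :: comm_ring_1"
  assumes up: "\<And>i j. i + 1 < j \<Longrightarrow> f i j = 0"
    and low: "\<And>i j. j + 1 < i \<Longrightarrow> f i j = 0"
  defines "M \<equiv> \<lambda>n. mat n n (\<lambda>(i, j). f i j)"
  shows "det (M (Suc (Suc n))) =
    f (Suc n) (Suc n) * det (M (Suc n)) - f n (Suc n) * f (Suc n) n * det (M n)"
proof -
  let ?A = "M (Suc (Suc n))"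
  define B where "B = mat_delete ?A (Suc n) n"
  have A: "?A \<in> carrier_mat (Suc (Suc n)) (Suc (Suc n))"
    by (simp add: M_def)
  have B: "B \<in> carrier_mat (Suc n) (Suc n)"
    unfolding B_def using mat_delete_carrier[OF A] by simp
  have entryB: "B $$ (i, n) = f i (Suc n)" if "i < Suc n" for i
    using that by (simp add: B_def mat_delete_def M_def)
  have delA: "mat_delete ?A (Suc n) (Suc n) = M (Suc n)"
    by (rule eq_matI) (auto simp: mat_delete_def M_def)
  have delB: "mat_delete B n n = M n"
    by (rule eq_matI) (auto simp: B_def mat_delete_def M_def)
  have "det B = (\<Sum>i<Suc n. B $$ (i, n) * cofactor B i n)"
    by (rule laplace_expansion_column[OF B]) simp
  also have "(\<Sum>i<n. B $$ (i, n) * cofactor B i n) = 0"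
    by (rule sum.neutral) (auto simp: entryB up)
  then have "(\<Sum>i<Suc n. B $$ (i, n) * cofactor B i n) = f n (Suc n) * det (M n)"
    by (simp add: entryB cofactor_def delB)
  finally have detB: "det B = f n (Suc n) * det (M n)" .
  have "det ?A = (\<Sum>j<Suc (Suc n). ?A $$ (Suc n, j) * cofactor ?A (Suc n) j)"
    by (rule laplace_expansion_row[OF A]) simp
  also have "(\<Sum>j<n. ?A $$ (Suc n, j) * cofactor ?A (Suc n) j) = 0"
    by (rule sum.neutral) (auto simp: M_def low)
  then have "(\<Sum>j<Suc (Suc n). ?A $$ (Suc n, j) * cofactor ?A (Suc n) j) =
      f (Suc n) n * cofactor ?A (Suc n) n + f (Suc n) (Suc n) * cofactor ?A (Suc n) (Suc n)"
    by (simp add: M_def)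
  also have "cofactor ?A (Suc n) n = - det B"
    by (simp add: cofactor_def B_def)
  also have "cofactor ?A (Suc n) (Suc n) = det (M (Suc n))"
    by (simp add: cofactor_def delA)
  finally show ?thesis
    by (simp add: detB algebra_simps)
qed

lemma eval2_eq: "eval2 P u v = poly (poly P [:u:]) v"
  unfolding eval2_def by (induction P) (auto simp: map_poly_pCons)

text \<open>The number a_k. It enters twice: as minus a diagonal entry of \<open>H_mat\<close>, and
  as the product of two mirrored off-diagonal entries divided by the square of
  \<open>\<mu>\<close>.\<close>

definition wt :: "nat \<Rightarrow> nat \<Rightarrow> complex" where
  "wt l k = of_nat k * (of_nat l - of_nat k)"

text \<open>These are the leading principal minors of the matrix in \<open>is_P\<close>; the second
  base case is \<open>u\<close> itself because a_0 = 0.\<close>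

fun continuant :: "nat \<Rightarrow> nat \<Rightarrow> complex poly poly" where
  "continuant l 0 = 1"
| "continuant l (Suc 0) = [:0, 1:]"
| "continuant l (Suc (Suc k)) =
    [:[:- wt l (Suc k):], 1:] * continuant l (Suc k) - [:[:0, wt l (Suc k):]:] * continuant l k"

lemma is_P_continuant: "is_P l (continuant l l)"
  unfolding is_P_def
proof (intro allI)
  fix lam \<mu> :: complex
  define f where "f = (\<lambda>i k :: nat. (let j = i + 1 in
     if k = i then (1 - of_nat j) * (of_nat l - of_nat j + 1)
     else if k = i + 1 then \<mu> * of_nat j
     else if k + 1 = i then \<mu> * (of_nat l - of_nat j + 1)
     else 0) + (if i = k then lam else 0))"
  have det: "det (mat k k (\<lambda>(i, j). f i j)) = eval2 (continuant l k) lam (\<mu>\<^sup>2)" for k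
  proof (induction k rule: induct_nat_012)
    case 0
    then show ?case by (simp add: eval2_eq)
  next
    case 1
    have "det (mat (Suc 0) (Suc 0) (\<lambda>(i, j). f i j)) = f 0 0"
      by (subst det_single) auto
    then show ?case by (simp add: eval2_eq f_def)
  next
    case (ge2 k)
    have zero: "i + 1 < j \<Longrightarrow> f i j = 0" "j + 1 < i \<Longrightarrow> f i j = 0" for i j
      by (simp_all add: f_def)
    have entries: "f (Suc k) (Suc k) = lam - wt l (Suc k)"
      "f k (Suc k) * f (Suc k) k = \<mu>\<^sup>2 * wt l (Suc k)"
      by (simp_all add: f_def wt_def algebra_simps power2_eq_square)
    have "det (mat (Suc (Suc k)) (Suc (Suc k)) (\<lambda>(i, j). f i j)) =
        (lam - wt l (Suc k)) * eval2 (continuant l (Suc k)) lam (\<mu>\<^sup>2) -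
        \<mu>\<^sup>2 * wt l (Suc k) * eval2 (continuant l k) lam (\<mu>\<^sup>2)"
      by (subst det_tridiagonal) (simp_all only: zero ge2 entries)
    then show ?case
      by (simp add: eval2_eq algebra_simps)
  qed
  have "H_mat l \<mu> + lam \<cdot>\<^sub>m 1\<^sub>m l = mat l l (\<lambda>(i, j). f i j)"
    by (rule eq_matI) (auto simp: H_mat_def f_def)
  with det[of l] show "det (H_mat l \<mu> + lam \<cdot>\<^sub>m 1\<^sub>m l) = eval2 (continuant l l) lam (\<mu>\<^sup>2)"
    by simp
qed

lemma eval2_inject:
  assumes "\<And>u v. eval2 P u v = eval2 Q u v"
  shows "P = Q"
proof (rule poly_eqI, rule poly_eqI)
  fix j i
  have "poly (coeff P j) v = poly (coeff Q j) v" for v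
  proof -
    have "map_poly (\<lambda>c. poly c v) P = map_poly (\<lambda>c. poly c v) Q"
      using assms[of _ v] unfolding eval2_def by (auto simp: poly_eq_poly_eq_iff[symmetric])
    then have "coeff (map_poly (\<lambda>c. poly c v) P) j = coeff (map_poly (\<lambda>c. poly c v) Q) j"
      by simp
    then show ?thesis by (simp add: coeff_map_poly)
  qed
  then have "coeff P j = coeff Q j" by (auto simp: poly_eq_poly_eq_iff[symmetric])
  then show "coeff (coeff P j) i = coeff (coeff Q j) i" by simp
qed

text \<open>Every complex \<open>v\<close> is a square, so the values at squares already determine
  the polynomial.\<close>

lemma is_P_unique:
  assumes "is_P l P" shows "P = continuant l l"
proof (rule eval2_inject)
  fix u v :: complex
  have "eval2 P u ((csqrt v)\<^sup>2) = eval2 (continuant l l) u ((csqrt v)\<^sup>2)"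
    using assms is_P_continuant[of l] unfolding is_P_def by metis
  then show "eval2 P u v = eval2 (continuant l l) u v" by simp
qed

section \<open>Sums of residues of rational functions\<close>

text \<open>If the cofactor of \<open>gcd p q\<close> in \<open>p\<close> had a root, its
  multiplicity in \<open>p\<close> would exceed that in the gcd, against the hypothesis.\<close>

lemma dvd_if_root_powers_dvd:
  fixes p q :: "complex poly"
  assumes p: "p \<noteq> 0" and pw: "\<And>x n. [:-x, 1:] ^ n dvd p \<Longrightarrow> [:-x, 1:] ^ n dvd q"
  shows "p dvd q"
proof -
  define g where "g = gcd p q"
  obtain h where h: "p = g * h" unfolding g_def by (meson dvdE gcd_dvd1)
  have "degree h = 0"
  proof (rule ccontr)
    assume "degree h \<noteq> 0"
    then obtain x where x: "poly h x = 0"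
      using fundamental_theorem_of_algebra constant_degree by metis
    have "[:-x, 1:] ^ order x p dvd g"
      unfolding g_def using pw[OF order_1] order_1 by (intro gcd_greatest)
    moreover have "g \<noteq> 0" using h p by auto
    ultimately have "order x p \<le> order x g" by (simp add: order_divides)
    moreover have "order x p = order x g + order x h"
      using p h order_mult by blast
    moreover have "order x h \<noteq> 0"
      using x h p by (auto simp: order_root)
    ultimately show False by simp
  qed
  then obtain c where "h = [:c:]" by (metis degree_eq_zeroE)
  with h p have "p dvd g"
    by (metis dvd_refl is_unit_const_poly_iff is_unit_triv mult_cancel_right mult_eq_0_iff mult_unit_dvd_iff pCons_0_0)
  then show ?thesis unfolding g_def by simp
qed

text \<open>Multiplicities are read off from derivatives. The last hypothesis limits the roots of
  \<open>p\<close> to multiplicity two, which suffices since each value a_k, \<open>k < l\<close>,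
  is taken at most twice.\<close>

lemma double_root_power_dvd:
  fixes p q :: "complex poly"
  assumes p: "[:-x, 1:] ^ n dvd p" "p \<noteq> 0"
    and "poly p x = 0 \<Longrightarrow> poly q x = 0"
    and "poly p x = 0 \<Longrightarrow> poly (pderiv p) x = 0 \<Longrightarrow>
           poly (pderiv (pderiv p)) x \<noteq> 0 \<and> poly (pderiv q) x = 0"
  shows "[:-x, 1:] ^ n dvd q"
proof (cases "q = 0")
  case False
  have n: "n \<le> order x p" using p by (simp add: order_divides)
  have "order x p \<le> order x q"
  proof (cases "poly p x = 0")
    case True
    then have q: "poly q x = 0" using assms by simp
    have op: "order x p = Suc (order x (pderiv p))" using order_pderiv p True by blast
    have oq: "order x q = Suc (order x (pderiv q))" using order_pderiv False q by blast
    show ?thesis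
    proof (cases "poly (pderiv p) x = 0")
      case True': True
      then have *: "poly (pderiv (pderiv p)) x \<noteq> 0" "poly (pderiv q) x = 0"
        using assms True by auto
      then have "pderiv p \<noteq> 0" by auto
      then have "order x (pderiv p) = Suc (order x (pderiv (pderiv p)))"
        using order_pderiv True' by blast
      then have "order x p = 2" using op * by (simp add: order_0I)
      moreover have "order x q \<ge> 2"
      proof -
        have "pderiv q \<noteq> 0"
          using q False by (metis constant_degree fundamental_theorem_of_algebra pderiv_eq_0_iff
              degree_eq_zeroE poly_const_conv pCons_0_0)
        then show ?thesis using oq *(2) by (metis One_nat_def Suc_leI Suc_1 Suc_le_mono neq0_conv order_root)
      qed
      ultimately show ?thesis by simp
    next
      case False
      then show ?thesis using op oq by (simp add: order_0I)
    qed
  qed (simp add: order_0I)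
  with n False show ?thesis by (simp add: order_divides)
qed simp

text \<open>
  The hypothesis on \<open>r\<close> says that \<open>q / p\<close> has at most simple poles with residues \<open>r x\<close>; the bound on
  the degree of \<open>q\<close> removes the residue at infinity.
\<close>
lemma sum_residues_eq_0:
  fixes p q :: "complex poly"
  assumes deg: "\<And>j. degree p \<le> Suc j \<Longrightarrow> coeff q j = 0" and p: "0 < degree p"
    and r: "\<And>x. poly p x = 0 \<Longrightarrow>
      (poly (pderiv p) x \<noteq> 0 \<and> poly q x = r x * poly (pderiv p) x) \<or>
      (poly (pderiv p) x = 0 \<and> poly q x = 0 \<and> poly (pderiv (pderiv p)) x \<noteq> 0 \<and>
        2 * poly (pderiv q) x = r x * poly (pderiv (pderiv p)) x)"
  shows "(\<Sum>x | poly p x = 0. r x) = 0"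
proof -
  have p0: "p \<noteq> 0" using p by auto
  let ?Z = "{x. poly p x = 0}"
  have fin: "finite ?Z" using p0 by (rule poly_roots_finite)
  \<comment> \<open>For a root \<open>x\<close> of \<open>p\<close>, the quotient of
    \<open>K x\<close> by \<open>p\<close> is the elementary fraction with pole at
    \<open>x\<close>.\<close>
  define K where "K x = p div [:-x, 1:]" for x
  have K: "p = [:-x, 1:] * K x" if "poly p x = 0" for x
    using that unfolding K_def by (metis dvd_mult_div_cancel poly_eq_0_iff_dvd)
  have degK: "coeff (K x) j = (if Suc j = degree p then lead_coeff p else 0)"
    if "poly p x = 0" "degree p \<le> Suc j" for x j
  proof -
    have K0: "K x \<noteq> 0" using K[OF that(1)] p0 by auto
    have dg: "degree p = Suc (degree (K x))"
      by (subst K[OF that(1)], subst degree_mult_eq) (use K0 in auto)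
    have lc: "lead_coeff p = lead_coeff (K x)"
      using arg_cong[OF K[OF that(1)], of lead_coeff] by (simp add: lead_coeff_mult del: mult_pCons_left)
    show ?thesis
      using dg lc that(2) by (auto intro!: coeff_eq_0)
  qed
  \<comment> \<open>The numerator of \<open>q / p\<close> minus its expected principal parts. It
    vanishes at the roots of \<open>p\<close> with multiplicity and has smaller degree, hence is
    0.\<close>
  define F where "F = q - (\<Sum>x\<in>?Z. smult (r x) (K x))"
  have K1: "poly (pderiv p) y = poly (K x) y + (y - x) * poly (pderiv (K x)) y"
    if "poly p x = 0" for x y
    by (subst K[OF that]) (simp add: pderiv_mult pderiv_pCons del: mult_pCons_left)
  \<comment> \<open>At a double root this turns the residue hypothesis, with its factor 2, into the
    vanishing of the derivative of \<open>F\<close>.\<close>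
  have K2: "poly (pderiv (pderiv p)) x = 2 * poly (pderiv (K x)) x"
    if "poly p x = 0" for x
    by (subst K[OF that]) (simp add: pderiv_mult pderiv_pCons pderiv_add del: mult_pCons_left)
  have Kz: "poly (K x) y = 0" if "poly p x = 0" "poly p y = 0" "x \<noteq> y" for x y
    using K[OF that(1)] that by (metis poly_mult mult_eq_0_iff poly_pCons poly_0 mult.right_neutral
       add.commute add_0_right eq_iff_diff_eq_0 mult_zero_right poly_1 pCons_one diff_conv_add_uminus)
  have Kz': "poly (pderiv (K x)) y = 0"
    if "poly p x = 0" "poly p y = 0" "x \<noteq> y" "poly (pderiv p) y = 0" for x y
    using K1[OF that(1), of y] Kz[OF that(1-3)] that by simp
  have "[:-y, 1:] ^ n dvd F" if n: "[:-y, 1:] ^ n dvd p" for y n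
  proof (rule double_root_power_dvd[OF n p0])
    assume y: "poly p y = 0"
    have "(\<Sum>x\<in>?Z. r x * poly (K x) y) = r y * poly (K y) y"
      by (rule sum.remove[OF fin, THEN trans, of y]) (auto simp: y Kz intro!: sum.neutral)
    also have "poly (K y) y = poly (pderiv p) y" using K1[OF y, of y] by simp
    finally have F: "poly F y = poly q y - r y * poly (pderiv p) y"
      by (simp add: F_def poly_sum)
    then show "poly F y = 0" using r[OF y] by auto
    assume y': "poly (pderiv p) y = 0"
    have "(\<Sum>x\<in>?Z. r x * poly (pderiv (K x)) y) = r y * poly (pderiv (K y)) y"
      by (rule sum.remove[OF fin, THEN trans, of y]) (auto simp: y y' Kz' intro!: sum.neutral)
    moreover have "poly (pderiv F) y = poly (pderiv q) y - (\<Sum>x\<in>?Z. r x * poly (pderiv (K x)) y)"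
      by (simp add: F_def pderiv_diff higher_pderiv_sum[of 1, simplified] pderiv_smult poly_sum)
    ultimately have "poly (pderiv F) y = poly (pderiv q) y - r y * poly (pderiv (K y)) y" by simp
    then show "poly (pderiv (pderiv p)) y \<noteq> 0 \<and> poly (pderiv F) y = 0"
      using r[OF y] y' K2[OF y] by auto
  qed
  then have "p dvd F" using dvd_if_root_powers_dvd[OF p0] by blast
  \<comment> \<open>At \<open>j = degree p - 1\<close> this is the sum of the residues, up to sign
    and leading coefficient.\<close>
  have cF: "coeff F j = - (\<Sum>x\<in>?Z. r x) * (if Suc j = degree p then lead_coeff p else 0)"
    if "degree p \<le> Suc j" for j
    using that by (simp add: F_def coeff_sum deg degK sum_distrib_right)
  have "degree F < degree p"
    using cF p by (intro degree_lessI) auto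
  with \<open>p dvd F\<close> have "F = 0" using dvd_imp_degree_le by (metis linorder_not_le)
  with cF[of "degree p - 1"] p p0 show ?thesis by auto
qed

section \<open>Coefficients in \<open>v\<close> and weighted degree\<close>

definition vcoeff :: "nat \<Rightarrow> complex poly poly \<Rightarrow> complex poly" where
  "vcoeff i P = map_poly (\<lambda>c. coeff c i) P"

lemma coeff_vcoeff [simp]: "coeff (vcoeff i P) j = coeff (coeff P j) i"
  by (simp add: vcoeff_def coeff_map_poly)

lemma vcoeff_pCons [simp]: "vcoeff i (pCons a P) = pCons (coeff a i) (vcoeff i P)"
  by (simp add: vcoeff_def map_poly_pCons)

lemma vcoeff_0 [simp]: "vcoeff i 0 = 0"
  by (simp add: vcoeff_def)

lemma vcoeff_0_mult: "vcoeff 0 (P * Q) = vcoeff 0 P * vcoeff 0 Q"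
  by (rule poly_eqI) (simp add: coeff_mult coeff_sum)

text \<open>Taylor expansion at (x, 0) in the direction (e, 1) up to second order; the last equation
  is doubled to avoid division.\<close>

lemma coeff_line:
  fixes x e :: complex
  shows "coeff (poly P [:x, e:]) 0 = poly (vcoeff 0 P) x" (is ?A)
    and "coeff (poly P [:x, e:]) (Suc 0) =
      e * poly (pderiv (vcoeff 0 P)) x + poly (vcoeff 1 P) x" (is ?B)
    and "2 * coeff (poly P [:x, e:]) 2 =
      e\<^sup>2 * poly (pderiv (pderiv (vcoeff 0 P))) x
      + 2 * e * poly (pderiv (vcoeff 1 P)) x + 2 * poly (vcoeff 2 P) x" (is ?C)
proof -
  have "?A \<and> ?B \<and> ?C"
  proof (induction P)
    case (pCons a P)
    then have A: "coeff (poly P [:x, e:]) 0 = poly (vcoeff 0 P) x"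
      and B: "coeff (poly P [:x, e:]) (Suc 0) =
        e * poly (pderiv (vcoeff 0 P)) x + poly (vcoeff 1 P) x"
      and C: "2 * coeff (poly P [:x, e:]) 2 =
      e\<^sup>2 * poly (pderiv (pderiv (vcoeff 0 P))) x
      + 2 * e * poly (pderiv (vcoeff 1 P)) x + 2 * poly (vcoeff 2 P) x" by auto
    have "2 * coeff (poly (pCons a P) [:x, e:]) 2 = 2 * coeff a 2 +
        x * (2 * coeff (poly P [:x, e:]) 2) + 2 * e * coeff (poly P [:x, e:]) (Suc 0)"
      by (simp add: numeral_2_eq_2 algebra_simps)
    then show ?case
      unfolding B C
      by (simp add: A B pderiv_pCons pderiv_add algebra_simps power2_eq_square)
  qed simp
  then show ?A ?B ?C by auto
qed

definition weight_le :: "complex poly poly \<Rightarrow> nat \<Rightarrow> bool" where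
  "weight_le P w \<longleftrightarrow> (\<forall>i j. coeff (coeff P j) i \<noteq> 0 \<longrightarrow> j + 2 * i \<le> w)"

lemma finite_poly2_support: "finite {(j, i). coeff (coeff (P :: 'a :: zero poly poly) j) i \<noteq> 0}"
proof (rule finite_subset)
  show "{(j, i). coeff (coeff P j) i \<noteq> 0} \<subseteq> (SIGMA j:{..degree P}. {..degree (coeff P j)})"
    using le_degree by (auto; metis coeff_0 le_degree)
qed auto

text \<open>Ties in weight are broken by the exponent of \<open>v\<close>, which singles out one
  term that cannot cancel in a product.\<close>

lemma top_term:
  assumes "P \<noteq> 0"
  obtains i j where "coeff (coeff P j) i \<noteq> 0" "weight_le P (j + 2 * i)"
    "\<forall>i' j'. coeff (coeff P j') i' \<noteq> 0 \<longrightarrow> j' + 2 * i' = j + 2 * i \<longrightarrow> i' \<le> i"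
proof -
  define S where "S = {(j, i). coeff (coeff P j) i \<noteq> 0}"
  have S: "finite S" "S \<noteq> {}"
    using finite_poly2_support[of P] assms by (auto simp: S_def poly_eq_iff)
  define W where "W = Max ((\<lambda>(j, i). j + 2 * i) ` S)"
  have W: "\<And>j i. (j, i) \<in> S \<Longrightarrow> j + 2 * i \<le> W"
    using S unfolding W_def by (auto intro!: Max_ge)
  define I where "I = {i. \<exists>j. (j, i) \<in> S \<and> j + 2 * i = W}"
  have "W \<in> (\<lambda>(j, i). j + 2 * i) ` S" unfolding W_def using S by (intro Max_in) auto
  then have I: "I \<noteq> {}" unfolding I_def by auto
  have fI: "finite I" by (rule finite_subset[of _ "snd ` S"]) (use S in \<open>force simp: I_def\<close>)+
  have "Max I \<in> I" using I fI by (rule Max_in[rotated])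
  then obtain j where j: "(j, Max I) \<in> S" "j + 2 * Max I = W" by (auto simp: I_def)
  show ?thesis
  proof (rule that[of j "Max I"])
    show "coeff (coeff P j) (Max I) \<noteq> 0" using j by (simp add: S_def)
    show "weight_le P (j + 2 * Max I)" using W j by (auto simp: weight_le_def S_def)
    have "i' \<le> Max I" if "coeff (coeff P j') i' \<noteq> 0" "j' + 2 * i' = j + 2 * Max I" for i' j'
    proof -
      have "i' \<in> I" using j that by (auto simp: I_def S_def)
      then show ?thesis using fI by simp
    qed
    then show "\<forall>i' j'. coeff (coeff P j') i' \<noteq> 0 \<longrightarrow> j' + 2 * i' = j + 2 * Max I \<longrightarrow> i' \<le> Max I"
      by blast
  qed
qed

text \<open>The two leading terms give the only contribution to the monomial of their product, so
  leading weights add.\<close>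

lemma weight_mult:
  assumes "P \<noteq> 0" "Q \<noteq> 0" "weight_le (P * Q) w"
  obtains w1 w2 where "weight_le P w1" "weight_le Q w2" "w1 + w2 \<le> w"
proof -
  obtain i j where P: "coeff (coeff P j) i \<noteq> 0" "weight_le P (j + 2 * i)"
    "\<forall>i' j'. coeff (coeff P j') i' \<noteq> 0 \<longrightarrow> j' + 2 * i' = j + 2 * i \<longrightarrow> i' \<le> i"
    by (rule top_term[OF assms(1)])
  obtain k m where Q: "coeff (coeff Q m) k \<noteq> 0" "weight_le Q (m + 2 * k)"
    "\<forall>i' j'. coeff (coeff Q j') i' \<noteq> 0 \<longrightarrow> j' + 2 * i' = m + 2 * k \<longrightarrow> i' \<le> k"
    by (rule top_term[OF assms(2)])
  let ?t = "\<lambda>(b, a). coeff (coeff P b) a * coeff (coeff Q (j + m - b)) (i + k - a)"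
  have z: "?t p = 0" if "p \<in> {..j + m} \<times> {..i + k} - {(j, i)}" for p
  proof (rule ccontr)
    obtain b a where p: "p = (b, a)" by force
    assume nz: "?t p \<noteq> 0"
    have ba: "b \<le> j + m" "a \<le> i + k" using that p by auto
    have 1: "b + 2 * a \<le> j + 2 * i" using nz P(2) p by (auto simp: weight_le_def)
    have 2: "(j + m - b) + 2 * (i + k - a) \<le> m + 2 * k" using nz Q(2) p by (auto simp: weight_le_def)
    have eq: "b + 2 * a = j + 2 * i" "(j + m - b) + 2 * (i + k - a) = m + 2 * k"
      using 1 2 ba by linarith+
    have "a \<le> i" "i + k - a \<le> k" using nz p P(3) Q(3) eq by auto
    then have "a = i" "b = j" using eq ba by auto
    with that p show False by simp
  qed
  have "coeff (coeff (P * Q) (j + m)) (i + k) = (\<Sum>p\<in>{..j + m} \<times> {..i + k}. ?t p)"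
    by (simp add: coeff_mult coeff_sum sum.cartesian_product)
  also have "\<dots> = ?t (j, i)"
    by (rule sum.remove[THEN trans, of _ "(j, i)"]) (use z in \<open>auto intro!: sum.neutral\<close>)
  finally have "coeff (coeff (P * Q) (j + m)) (i + k) \<noteq> 0" using P(1) Q(1) by simp
  then have "j + m + 2 * (i + k) \<le> w" using assms(3) unfolding weight_le_def by blast
  then show ?thesis using that[OF P(2) Q(2)] by simp
qed

text \<open>The weight is at least the degree of the part at \<open>v = 0\<close>, and both are
  additive; equality for the product forces equality for each factor.\<close>

lemma weight_le_factor:
  assumes "weight_le (P * Q) (degree (vcoeff 0 (P * Q)))" "vcoeff 0 (P * Q) \<noteq> 0"
  shows "weight_le P (degree (vcoeff 0 P))"
proof -
  have nz: "vcoeff 0 P \<noteq> 0" "vcoeff 0 Q \<noteq> 0" using assms by (auto simp: vcoeff_0_mult)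
  then have "P \<noteq> 0" "Q \<noteq> 0" by auto
  then obtain w1 w2 where w: "weight_le P w1" "weight_le Q w2"
     "w1 + w2 \<le> degree (vcoeff 0 (P * Q))"
    using assms weight_mult by blast
  have "degree (vcoeff 0 P) \<le> w1" "degree (vcoeff 0 Q) \<le> w2"
    using w nz leading_coeff_0_iff[of "vcoeff 0 P"] leading_coeff_0_iff[of "vcoeff 0 Q"]
    by (force simp: weight_le_def simp del: leading_coeff_0_iff)+
  moreover have "degree (vcoeff 0 (P * Q)) = degree (vcoeff 0 P) + degree (vcoeff 0 Q)"
    using nz by (simp add: vcoeff_0_mult degree_mult_eq)
  ultimately have "w1 = degree (vcoeff 0 P)" using w by linarith
  with w show ?thesis by simp
qed

text \<open>The monomial \<open>u^j v\<close> has weight \<open>j + 2\<close>. This is the degree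
  bound that \<open>sum_residues_eq_0\<close> asks for.\<close>

lemma weight_le_coeff_1:
  assumes "weight_le P w" "w \<le> Suc j"
  shows "coeff (vcoeff 1 P) j = 0"
  using assms by (force simp: weight_le_def)

lemma weight_le_0_const:
  assumes "weight_le P 0"
  shows "P = [:[:coeff (coeff P 0) 0:]:]"
proof (intro poly_eqI)
  fix i j
  show "coeff (coeff P j) i = coeff (coeff [:[:coeff (coeff P 0) 0:]:] j) i"
    using assms by (cases i; cases j) (force simp: weight_le_def)+
qed

lemma weight_le_continuant: "weight_le (continuant l k) k"
proof (induction k rule: induct_nat_012)
  case (ge2 k)
  have *: "coeff (coeff (continuant l (Suc (Suc k))) j) i =
     (case j of 0 \<Rightarrow> 0 | Suc j \<Rightarrow> coeff (coeff (continuant l (Suc k)) j) i)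
     - wt l (Suc k) * coeff (coeff (continuant l (Suc k)) j) i
     - wt l (Suc k) * (case i of 0 \<Rightarrow> 0 | Suc i \<Rightarrow> coeff (coeff (continuant l k) j) i)" for i j
    by (simp add: coeff_pCons split: nat.splits)
  show ?case
    unfolding weight_le_def
  proof (intro allI impI)
    fix i j assume nz: "coeff (coeff (continuant l (Suc (Suc k))) j) i \<noteq> 0"
    have "(\<exists>j'. j = Suc j' \<and> coeff (coeff (continuant l (Suc k)) j') i \<noteq> 0) \<or>
      coeff (coeff (continuant l (Suc k)) j) i \<noteq> 0 \<or> (\<exists>i'. i = Suc i' \<and> coeff (coeff (continuant l k) j) i' \<noteq> 0)"
      using nz unfolding * by (auto split: nat.splits)
    with ge2 show "j + 2 * i \<le> Suc (Suc k)" by (fastforce simp: weight_le_def)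
  qed
qed (auto simp: weight_le_def coeff_pCons split: nat.splits)

lemma vcoeff_0_continuant: "vcoeff 0 (continuant l k) = (\<Prod>i<k. [:- wt l i, 1:])"
proof (induction k rule: induct_nat_012)
  case (ge2 k)
  have "vcoeff 0 (P - [:[:0, c:]:] * Q) = vcoeff 0 P" for P Q c
    by (rule poly_eqI) simp
  then show ?case
    by (simp add: vcoeff_0_mult ge2 mult.commute del: mult_pCons_left mult_pCons_right)
qed (auto simp: wt_def one_pCons)

lemma degree_vcoeff_0_continuant: "degree (vcoeff 0 (continuant l k)) = k"
  by (simp add: vcoeff_0_continuant degree_prod_eq_sum_degree)

section \<open>Expansion of \<open>P\<close> on lines through the points (a_k, 0)\<close>

text \<open>The difference of the values is (i - j)(l - i - j). Hence the roots of P(u, 0) are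
  double, from pairs \<open>k\<close> and \<open>l - k\<close>, except for simple ones at k = 0 and
  k = l/2.\<close>

lemma wt_eq_iff: "wt l i = wt l j \<longleftrightarrow> i = j \<or> i + j = l"
proof -
  have "wt l i - wt l j = (of_nat i - of_nat j) * (of_nat l - of_nat (i + j))"
    by (simp add: wt_def algebra_simps)
  then have "wt l i = wt l j \<longleftrightarrow> of_nat i = (of_nat j :: complex) \<or> of_nat l = (of_nat (i + j) :: complex)"
    by (metis eq_iff_diff_eq_0 mult_eq_0_iff)
  then show ?thesis by (auto simp del: of_nat_add)
qed

lemma wt_0 [simp]: "wt l 0 = 0" and wt_self [simp]: "wt l l = 0"
  by (simp_all add: wt_def)

lemma wt_diff: "k \<le> l \<Longrightarrow> wt l (l - k) = wt l k"
  by (simp add: wt_eq_iff)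

lemma wt_Suc: "wt l (Suc k) = wt l k + (of_nat l - 2 * of_nat k - 1)"
  by (simp add: wt_def algebra_simps)

text \<open>Evaluating the outer variable at \<open>[:x, e:]\<close> restricts a bivariate polynomial to the line \<open>u = x + e v\<close>.\<close>
definition line_coeff :: "nat \<Rightarrow> complex \<Rightarrow> complex \<Rightarrow> nat \<Rightarrow> nat \<Rightarrow> complex" where
  "line_coeff l x e i j = coeff (poly (continuant l j) [:x, e:]) i"

lemma line_coeff_0_0 [simp]: "line_coeff l x e 0 0 = 1" and line_coeff_Suc_0 [simp]: "line_coeff l x e (Suc i) 0 = 0"
  by (simp_all add: line_coeff_def)

lemma line_coeff_0_Suc: "line_coeff l x e 0 (Suc j) = (x - wt l j) * line_coeff l x e 0 j"
  by (cases j) (simp_all add: line_coeff_def algebra_simps)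

lemma line_coeff_Suc_1: "line_coeff l x e (Suc i) (Suc 0) = e * (if i = 0 then 1 else 0)"
  by (simp add: line_coeff_def coeff_pCons split: nat.splits)

lemma line_coeff_Suc_Suc:
  "line_coeff l x e (Suc i) (Suc (Suc j)) = (x - wt l (Suc j)) * line_coeff l x e (Suc i) (Suc j)
    + e * line_coeff l x e i (Suc j) - wt l (Suc j) * line_coeff l x e i j"
  by (simp add: line_coeff_def algebra_simps)

lemma line_coeff_0_propagate:
  assumes "p \<le> q"
  shows "line_coeff l x e 0 q = line_coeff l x e 0 p * (\<Prod>m=p..<q. x - wt l m)"
  using assms by (induction q rule: dec_induct) (simp_all add: line_coeff_0_Suc)

text \<open>Once the coefficients of \<open>v^i\<close> vanish, only the diagonal term of the
  recursion remains. The bound \<open>j0 < p\<close> is strict because the recursion reaches back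
  two indices.\<close>

lemma line_coeff_Suc_propagate:
  assumes z: "\<And>j. j0 \<le> j \<Longrightarrow> line_coeff l x e i j = 0" and "j0 < p" "p \<le> q"
  shows "line_coeff l x e (Suc i) q = line_coeff l x e (Suc i) p * (\<Prod>m=p..<q. x - wt l m)"
  using assms(3)
proof (induction q rule: dec_induct)
  case (step q)
  then obtain r where r: "q = Suc r" "j0 \<le> r" using assms(2) by (cases q) auto
  show ?case
    using step unfolding r(1) by (simp add: line_coeff_Suc_Suc z r(2) le_SucI)
qed simp

text \<open>The factor x - a_(k+1) = 0 kills the constant term from index k + 2 on. The coefficient
  of \<open>v\<close> receives lower terms at k + 2 and k + 3 and is merely multiplied
  afterwards.\<close>

lemma line_coeff_simple:
  fixes k l :: nat
  defines "x \<equiv> wt l (Suc k)"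
  shows "Suc (Suc k) \<le> j \<Longrightarrow> line_coeff l x e 0 j = 0" (is "_ \<Longrightarrow> ?A")
    and "line_coeff l x e 1 (Suc (Suc k)) = line_coeff l x e 0 k * (e * (x - wt l k) - x)" (is ?B)
    and "Suc (Suc (Suc k)) \<le> j \<Longrightarrow> line_coeff l x e 1 j =
      line_coeff l x e 0 k * ((x - wt l (Suc (Suc k))) * (e * (x - wt l k) - x)
        - wt l (Suc (Suc k)) * (x - wt l k)) * (\<Prod>m=Suc (Suc (Suc k))..<j. x - wt l m)"
      (is "_ \<Longrightarrow> ?C")
proof -
  have 0: "line_coeff l x e 0 j = 0" if "Suc (Suc k) \<le> j" for j
    using that by (subst line_coeff_0_propagate[OF that]) (simp add: line_coeff_0_Suc x_def)
  then show "Suc (Suc k) \<le> j \<Longrightarrow> ?A" .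
  show B: ?B
    by (simp add: line_coeff_Suc_Suc line_coeff_0_Suc x_def algebra_simps)
  have "line_coeff l x e 1 (Suc (Suc (Suc k))) = line_coeff l x e 0 k * ((x - wt l (Suc (Suc k))) * (e * (x - wt l k) - x)
        - wt l (Suc (Suc k)) * (x - wt l k))"
    using line_coeff_Suc_Suc[of l x e 0 "Suc k"] 0[of "Suc (Suc k)"] B line_coeff_0_Suc[of l x e k]
    by (simp add: mult.assoc) (simp add: algebra_simps)
  then show "Suc (Suc (Suc k)) \<le> j \<Longrightarrow> ?C"
    using line_coeff_Suc_propagate[of "Suc (Suc k)" l x e 0 "Suc (Suc (Suc k))" j, OF 0] by simp
qed

text \<open>The denominators are the gaps a_k - a_(k-1) and a_(k+1) - a_k: this is second-order
  perturbation theory in \<open>\<mu>\<close>, with one term for each neighbour of a_k.\<close>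

definition shift :: "nat \<Rightarrow> nat \<Rightarrow> complex" where
  "shift l k = wt l k / (of_nat l - 2 * of_nat k + 1) - wt l (Suc k) / (of_nat l - 2 * of_nat k - 1)"

lemma gap_nonzero:
  assumes "2 * k + 2 \<le> l"
  shows "of_nat l - 2 * of_nat k + (1 :: complex) \<noteq> 0" "of_nat l - 2 * of_nat k - (1 :: complex) \<noteq> 0"
proof -
  obtain d where d: "l = 2 * k + 2 + d" using assms le_Suc_ex by blast
  have "of_nat l - 2 * of_nat k + (1 :: complex) = of_nat (3 + d)"
       "of_nat l - 2 * of_nat k - (1 :: complex) = of_nat (1 + d)" unfolding d by simp_all
  then show "of_nat l - 2 * of_nat k + (1 :: complex) \<noteq> 0" "of_nat l - 2 * of_nat k - (1 :: complex) \<noteq> 0"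
    by (metis of_nat_eq_0_iff add_is_0 zero_neq_numeral zero_neq_one)+
qed

text \<open>
  At the double root \<open>a\<^sub>k = a\<^sub>l\<^sub>-\<^sub>k\<close> both branches have the same displacement \<open>shift l k\<close>, unless the
  indices \<open>k\<close> and \<open>l - k\<close> have distance 2: then they interact and split by \<open>\<plusminus>\<close> the square root of
  \<open>a\<^sub>k a\<^sub>k\<^sub>+\<^sub>1\<close>. The recursion is run one step beyond \<open>l\<close>, where it multiplies by \<open>x\<close>, so that
  \<open>k = 1\<close> needs no separate treatment.
\<close>
lemma line_coeff_pair:
  fixes k l :: nat
  assumes k: "1 \<le> k" "2 * k + 2 \<le> l"
  defines "x \<equiv> wt l k"
  shows "line_coeff l x e 0 l = 0" "line_coeff l x e 1 l = 0"
    and "\<exists>C. C \<noteq> 0 \<and> (\<forall>e. line_coeff l x e 2 l =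
      C * ((e - shift l k)\<^sup>2 - (if l = 2 * k + 2 then wt l k * wt l (Suc k) else 0)))"
proof -
  obtain h where h: "k = Suc h" using k by (cases k) auto
  obtain d where d: "l = 2 * k + 2 + d" using k le_Suc_ex by blast
  \<comment> \<open>This is \<open>l - k\<close>, written as a sum to avoid truncated
    subtraction.\<close>
  define k' where "k' = h + d + 3"
  have k': "l = k + k'" "l - k = k'" "Suc k \<le> k'" using d h by (auto simp: k'_def)
  \<comment> \<open>The gaps from \<open>x\<close> to its neighbours; around the mirrored index
    \<open>k'\<close> they occur in reverse order.\<close>
  define y1 y2 where "y1 = x - wt l h" and "y2 = x - wt l (Suc k)"
  have y1: "y1 = of_nat l - 2 * of_nat k + 1"
    using wt_Suc[of l h] by (simp add: y1_def x_def h algebra_simps)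
  have y2: "y2 = - (of_nat l - 2 * of_nat k - 1)"
    using wt_Suc[of l k] by (simp add: y2_def x_def algebra_simps)
  have ynz: "y1 \<noteq> 0" "y2 \<noteq> 0"
    unfolding y1 y2 neg_equal_0_iff_equal by (rule gap_nonzero[OF k(2)])+
  have s: "shift l k = x / y1 + wt l (Suc k) / y2"
    unfolding shift_def y1 y2 x_def by (simp only: divide_minus_right diff_conv_add_uminus)
  have sh: "y1 * y2 * shift l k = x * y2 + wt l (Suc k) * y1"
    unfolding s distrib_left using ynz by (simp add: mult.commute)
  have xk': "wt l k' = x" unfolding x_def k'(2)[symmetric] by (rule wt_diff) (use k in simp)
  have ck': "wt l (Suc k') = wt l h"
    unfolding wt_eq_iff using d h by (auto simp: k'_def)
  have bk': "wt l (k' - 1) = wt l (Suc k)"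
    unfolding wt_eq_iff using d h by (auto simp: k'_def)
  have xnz: "x \<noteq> 0" unfolding x_def using wt_eq_iff[of l k 0] k by auto
  have nz: "x - wt l m \<noteq> 0" if "m \<noteq> k" "m \<noteq> k'" for m
    unfolding x_def using wt_eq_iff[of l k m] that k' by auto
  define A where "A = (\<Prod>m<h. x - wt l m)"
  have A: "A = line_coeff l x e 0 h" for e
    using line_coeff_0_propagate[of 0 h l x e] by (simp add: A_def atLeast0LessThan)
  have Anz: "A \<noteq> 0" unfolding A_def using nz h by (auto simp: k'_def)
  have c0: "line_coeff l x e 0 j = 0" if "Suc k \<le> j" for e j
    using line_coeff_simple(1)[of h j l e] that by (simp add: h x_def)
  have c1: "line_coeff l x e 1 j = A * (y1 * y2 * (e - shift l k)) * (\<Prod>m=Suc (Suc k)..<j. x - wt l m)"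
    if "Suc (Suc k) \<le> j" for e j
  proof -
    have "y2 * (e * y1 - x) - wt l (Suc k) * y1 = y1 * y2 * (e - shift l k)"
      using sh by (simp add: algebra_simps)
    then show ?thesis
      using line_coeff_simple(3)[of h j l e] that by (simp add: h[symmetric] x_def[symmetric] A[of e] y1_def y2_def)
  qed
  \<comment> \<open>The factor of index \<open>k'\<close> vanishes and kills the linear coefficient
    too.\<close>
  have c1z: "line_coeff l x e 1 j = 0" if "Suc k' \<le> j" for e j
  proof -
    have "(\<Prod>m=Suc (Suc k)..<j. x - wt l m) = 0"
      using that xk' h by (intro prod_zero) (auto intro!: bexI[of _ k'] simp: k'_def)
    moreover have "Suc (Suc k) \<le> j" using that k' by auto
    ultimately show ?thesis using c1[of j e] by simp
  qed
  have "k' < l" using k' k by simp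
  then show "line_coeff l x e 0 l = 0" "line_coeff l x e 1 l = 0"
    using c0[of l e] c1z[of l e] k' by auto
  \<comment> \<open>The range ends at \<open>l\<close> because of the extra step of the recursion;
    for \<open>k = 1\<close> it is empty.\<close>
  define N where "N = (\<Prod>m=Suc (Suc k')..<Suc l. x - wt l m)"
  have Nnz: "N \<noteq> 0" unfolding N_def prod_zero_iff[OF finite_atLeastLessThan] using nz k'(3) by force
  obtain g where g: "k' = Suc g" by (auto simp: k'_def)
  have c2: "x * line_coeff l x e 2 l = N * (y1 * (e * line_coeff l x e 1 k' - x * line_coeff l x e 1 g)
     - wt l h * line_coeff l x e 1 k')" for e
  proof -
    have "line_coeff l x e 2 (Suc k') = e * line_coeff l x e 1 k' - x * line_coeff l x e 1 g"
      using line_coeff_Suc_Suc[of l x e 1 g] xk' by (simp add: g numeral_2_eq_2)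
    moreover have "line_coeff l x e 2 (Suc (Suc k')) = y1 * line_coeff l x e 2 (Suc k') - wt l h * line_coeff l x e 1 k'"
      using line_coeff_Suc_Suc[of l x e 1 k'] c1z[of "Suc k'" e] by (simp add: ck' y1_def numeral_2_eq_2)
    moreover have "line_coeff l x e 2 (Suc l) = line_coeff l x e 2 (Suc (Suc k')) * N"
      unfolding N_def numeral_2_eq_2
      by (rule line_coeff_Suc_propagate[of "Suc k'"]) (use c1z k' k in auto)
    moreover have "line_coeff l x e 2 (Suc l) = x * line_coeff l x e 2 l"
      using line_coeff_Suc_Suc[of l x e 1 "l - 1"] c1z[of l e] \<open>k' < l\<close> by (simp add: numeral_2_eq_2)
    ultimately show ?thesis by simp
  qed
  show "\<exists>C. C \<noteq> 0 \<and> (\<forall>e. line_coeff l x e 2 l =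
      C * ((e - shift l k)\<^sup>2 - (if l = 2 * k + 2 then wt l k * wt l (Suc k) else 0)))"
  proof (cases "d = 0")
    case True
    then have gk: "g = Suc k" "k' = Suc (Suc k)" using g h k'_def by auto
    have y2': "y2 = -1" using True d y2 by simp
    have b: "wt l (Suc k) = x + 1" using y2' by (simp add: y2_def algebra_simps)
    have "x * line_coeff l x e 2 l = - N * A * y1\<^sup>2 * ((e - shift l k)\<^sup>2 - x * wt l (Suc k))" for e
    proof -
      \<comment> \<open>Here \<open>g = k + 1\<close> lies before the range of \<open>c1\<close>, so
        the factor \<open>e - shift l k\<close> is missing; this causes the splitting.\<close>
      have "line_coeff l x e 1 g = A * (e * y1 - x)"
        using line_coeff_simple(2)[of l h e] by (simp add: gk h[symmetric] x_def[symmetric] A[of e] y1_def)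
      moreover have "line_coeff l x e 1 k' = - A * y1 * (e - shift l k)"
        using c1[of k' e] gk y2' by simp
      moreover have "wt l h = x - y1" by (simp add: y1_def)
      moreover have "y1 * shift l k = x - y1 * (x + 1)"
        using sh unfolding b y2' by (simp add: algebra_simps)
      then have "x = y1 * shift l k + y1 * (x + 1)" by simp
      moreover have "y1 * (e * (- A * y1 * (e - shift l k)) - x * (A * (e * y1 - x)))
          - (x - y1) * (- A * y1 * (e - shift l k)) = - A * y1\<^sup>2 * ((e - shift l k)\<^sup>2 - x * (x + 1))"
        proof -
          \<comment> \<open>An identity for arbitrary \<open>S\<close>; the last factor on the right
            vanishes at \<open>S = shift l k\<close>.\<close>
          have "y1 * (e * (- A * y1 * (e - S)) - x * (A * (e * y1 - x)))
            - (x - y1) * (- A * y1 * (e - S)) + A * y1\<^sup>2 * ((e - S)\<^sup>2 - x * (x + 1))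
            = A * y1 * (e - S + x) * (x - (y1 * S + y1 * (x + 1)))" for S
            by (simp add: algebra_simps power2_eq_square)
          moreover have "x - (y1 * shift l k + y1 * (x + 1)) = 0"
            using \<open>x = y1 * shift l k + y1 * (x + 1)\<close> by (simp only: right_minus_eq)
          ultimately have "y1 * (e * (- A * y1 * (e - shift l k)) - x * (A * (e * y1 - x)))
            - (x - y1) * (- A * y1 * (e - shift l k)) + A * y1\<^sup>2 * ((e - shift l k)\<^sup>2 - x * (x + 1)) = 0"
            by (simp only: mult_zero_right)
          then show ?thesis
            by (subst (asm) eq_neg_iff_add_eq_0[symmetric]) (simp only: mult_minus_left)
        qed
      ultimately show ?thesis
        unfolding c2 b by (simp add: mult.assoc)
    qed
    then have final: "line_coeff l x e 2 l = - N * A * y1\<^sup>2 / x * ((e - shift l k)\<^sup>2 - x * wt l (Suc k))" for e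
      using xnz by (simp add: field_simps)
    have nzC: "- N * A * y1\<^sup>2 / x \<noteq> 0" using Nnz Anz ynz xnz by simp
    have D: "(if l = 2 * k + 2 then wt l k * wt l (Suc k) else 0) = x * wt l (Suc k)"
      using True d by (simp add: x_def)
    show ?thesis unfolding D using nzC final by blast
  next
    case False
    then have gk: "Suc (Suc k) \<le> g" using g h k'_def by auto
    define M where "M = (\<Prod>m=Suc (Suc k)..<g. x - wt l m)"
    have Mnz: "M \<noteq> 0" unfolding M_def prod_zero_iff[OF finite_atLeastLessThan] using nz g by force
    have "x * line_coeff l x e 2 l = N * M * A * (y1 * y2)\<^sup>2 * (e - shift l k)\<^sup>2" for e
    proof -
      have g1: "line_coeff l x e 1 g = A * (y1 * y2 * (e - shift l k)) * M"
        unfolding M_def by (rule c1[OF gk])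
      have "line_coeff l x e 1 k' = line_coeff l x e 1 g * y2"
        using line_coeff_Suc_propagate[of "Suc k" l x e 0 g k'] c0 gk g bk' by (simp add: y2_def)
      then have "x * line_coeff l x e 2 l = N * line_coeff l x e 1 g * (y1 * (e * y2 - x) - wt l h * y2)"
        unfolding c2 by (simp add: algebra_simps)
      \<comment> \<open>Passing the mirrored index reproduces the factor
        \<open>e - shift l k\<close>, whence the square.\<close>
      also have "y1 * (e * y2 - x) - wt l h * y2 = y1 * y2 * (e - shift l k)"
      proof -
        have W: "wt l (Suc k) = x - y2" and wh: "wt l h = x - y1" by (simp_all add: y1_def y2_def)
        have "y1 * y2 * (e - shift l k) = y1 * y2 * e - (x * y2 + (x - y2) * y1)"
          by (simp only: right_diff_distrib sh W)
        then show ?thesis unfolding wh by (simp add: algebra_simps)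
      qed
      finally show ?thesis unfolding g1 by (simp add: algebra_simps power2_eq_square)
    qed
    then have final: "line_coeff l x e 2 l = N * M * A * (y1 * y2)\<^sup>2 / x * (e - shift l k)\<^sup>2" for e
      using xnz by (simp add: field_simps)
    have nzC: "N * M * A * (y1 * y2)\<^sup>2 / x \<noteq> 0" using Nnz Mnz Anz ynz xnz by simp
    have D: "(if l = 2 * k + 2 then wt l k * wt l (Suc k) else 0) = 0"
      using False d by simp
    show ?thesis unfolding D diff_zero using nzC final by blast
  qed
qed

text \<open>The simple root a_0 = 0 has a_1 as its only neighbour, so its displacement is a_1 / (a_0
  - a_1) = -1.\<close>

lemma line_coeff_origin:
  assumes "2 \<le> l"
  shows "\<exists>C. C \<noteq> 0 \<and> (\<forall>e. line_coeff l 0 e 1 l = C * (e + 1))"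
proof -
  have c0: "line_coeff l 0 e 0 j = 0" if "1 \<le> j" for e j
    using line_coeff_0_propagate[OF that] by (simp add: line_coeff_0_Suc)
  have c2: "line_coeff l 0 e 1 2 = - wt l 1 * (e + 1)" for e
    using line_coeff_Suc_Suc[of l 0 e 0 0] c0[of 1 e] line_coeff_Suc_1[of l 0 e 0]
    by (simp add: numeral_2_eq_2 eq_neg_iff_add_eq_0 algebra_simps)
  have "line_coeff l 0 e 1 l = line_coeff l 0 e 1 2 * (\<Prod>m=2..<l. - wt l m)" for e
    using line_coeff_Suc_propagate[of 1 l 0 e 0 2 l] c0 assms by simp
  moreover have "wt l m \<noteq> 0" if "0 < m" "m < l" for m
    using that wt_eq_iff[of l m 0] by auto
  then have "- wt l 1 * (\<Prod>m=2..<l. - wt l m) \<noteq> 0" using assms by (auto simp: prod_zero_iff)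
  ultimately show ?thesis unfolding c2
    by (intro exI[of _ "- wt l 1 * (\<Prod>m=2..<l. - wt l m)"]) (simp add: algebra_simps)
qed

text \<open>For even \<open>l\<close> the top root is simple and the derivative in \<open>u\<close>
  does not vanish; for odd \<open>l\<close> it is double, but the derivative in \<open>v\<close>
  does not vanish.\<close>

lemma line_coeff_top:
  assumes "2 \<le> l"
  shows "\<exists>e. line_coeff l (wt l (l div 2)) e 1 l \<noteq> 0"
proof -
  define x where "x = wt l (l div 2)"
  obtain k where k: "l div 2 = Suc k" using assms by (cases "l div 2") auto
  have nz: "x - wt l m \<noteq> 0" if "m \<noteq> Suc k" "m + Suc k \<noteq> l" for m
    unfolding x_def using wt_eq_iff[of l "Suc k" m] that k by auto
  have xnz: "x \<noteq> 0" using nz[of 0] k assms by simp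
  define A N where "A = (\<Prod>m<k. x - wt l m)" and "N = (\<Prod>m=Suc (Suc (Suc k))..<Suc l. x - wt l m)"
  have A: "A = line_coeff l x e 0 k" for e
    using line_coeff_0_propagate[of 0 k l x e] by (simp add: A_def atLeast0LessThan)
  have "A \<noteq> 0" unfolding A_def using nz k by auto
  have "x - wt l m \<noteq> 0" if "Suc (Suc (Suc k)) \<le> m" for m
    by (rule nz) (use that k in presburger)+
  then have "N \<noteq> 0" unfolding N_def by (metis (no_types, lifting) atLeastLessThan_iff finite_atLeastLessThan prod_zero_iff)
  have lk: "Suc (Suc k) \<le> l" using k assms by presburger
  have eq: "x * line_coeff l x e 1 l = A * ((x - wt l (Suc (Suc k))) * (e * (x - wt l k) - x)
        - wt l (Suc (Suc k)) * (x - wt l k)) * N" for e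
  proof -
    \<comment> \<open>The step beyond \<open>l\<close> multiplies by \<open>x\<close> and makes
      \<open>line_coeff_simple(3)\<close> applicable also for \<open>l = 2\<close>.\<close>
    have "x * line_coeff l x e 1 l = line_coeff l x e 1 (Suc l)"
      using line_coeff_Suc_Suc[of l x e 0 "l - 1"] line_coeff_simple(1)[of k l l e] lk k by (simp add: x_def)
    then show ?thesis
      using line_coeff_simple(3)[of k "Suc l" l e] lk unfolding N_def A[of e] x_def k by (simp only:)
  qed
  have nk: "x - wt l k \<noteq> 0" using k by (intro nz) presburger+
  have "\<exists>e. (x - wt l (Suc (Suc k))) * (e * (x - wt l k) - x)
        - wt l (Suc (Suc k)) * (x - wt l k) \<noteq> 0"
  proof (cases "x = wt l (Suc (Suc k))")
    case True
    then show ?thesis using nk xnz by simp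
  next
    case False
    let ?f = "\<lambda>e. (x - wt l (Suc (Suc k))) * (e * (x - wt l k) - x)
        - wt l (Suc (Suc k)) * (x - wt l k)"
    have "?f 1 - ?f 0 = (x - wt l (Suc (Suc k))) * (x - wt l k)"
      by (simp add: algebra_simps)
    moreover have "(x - wt l (Suc (Suc k))) * (x - wt l k) \<noteq> 0" using False nk by simp
    ultimately have "?f 1 \<noteq> ?f 0" by (metis (no_types, lifting) diff_self)
    then show ?thesis by metis
  qed
  with eq \<open>A \<noteq> 0\<close> \<open>N \<noteq> 0\<close> xnz show ?thesis unfolding x_def[symmetric]
    by (metis mult_eq_0_iff)
qed

section \<open>Residues of a factor\<close>

lemma coeff_mult_012:
  fixes p q :: "complex poly"
  shows "coeff (p * q) 0 = coeff p 0 * coeff q 0"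
    and "coeff (p * q) 1 = coeff p 0 * coeff q 1 + coeff p 1 * coeff q 0"
    and "coeff (p * q) 2 = coeff p 0 * coeff q 2 + coeff p 1 * coeff q 1 + coeff p 2 * coeff q 0"
  by (simp_all add: coeff_mult numeral_2_eq_2 algebra_simps)

lemma affine_eq_iff:
  fixes a b c d :: complex
  assumes "\<And>e. e * a + b = e * c + d"
  shows "a = c" "b = d"
  using assms[of 0] assms[of 1] by auto

lemma quadratic_eq_iff:
  fixes a b c a' b' c' :: complex
  assumes "\<And>e. e\<^sup>2 * a + e * b + c = e\<^sup>2 * a' + e * b' + c'"
  shows "a = a'" "b = b'" "c = c'"
proof -
  show c: "c = c'" using assms[of 0] by simp
  have 1: "a + b = a' + b'" "a - b = a' - b'" using assms[of 1] assms[of "-1"] c by auto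
  have "2 * a = (a + b) + (a - b)" by simp
  also have "\<dots> = 2 * a'" unfolding 1 by simp
  finally show "a = a'" by simp
  with 1 show "b = b'" by simp
qed

definition pos_rat :: "complex \<Rightarrow> bool" where
  "pos_rat r \<longleftrightarrow> r \<in> \<rat> \<and> 0 < Re r"

lemma wt_real: "wt l k = of_real (real k * (real l - real k))"
  by (simp add: wt_def)

text \<open>In \<open>shift\<close> the subtracted fraction has the larger numerator and the smaller
  denominator, as a_(k+1) = a_k + (l - 2k - 1).\<close>

lemma pos_rat_shift:
  assumes "2 * k + 2 \<le> l"
  shows "pos_rat (- shift l k)"
proof -
  define n where "n = real l - 2 * real k"
  have n: "2 \<le> n" using assms unfolding n_def by linarith
  define a b where "a = real k * (real l - real k)" and "b = real (Suc k) * (real l - real (Suc k))"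
  have ab: "b = a + (n - 1)" by (simp add: a_def b_def n_def algebra_simps)
  have a: "0 \<le> a" unfolding a_def using assms by simp
  have eq: "shift l k = of_real (a / (n + 1) - b / (n - 1))"
    by (simp add: shift_def wt_real a_def b_def n_def)
  have "a / (n + 1) \<le> a / (n - 1)" using a n by (intro divide_left_mono) auto
  also have "\<dots> < b / (n - 1)" using n ab by (intro divide_strict_right_mono) auto
  finally have "Re (- shift l k) > 0" by (simp add: eq)
  moreover have "shift l k \<in> \<rat>" unfolding shift_def wt_def
    by (intro Rats_diff Rats_divide Rats_mult Rats_add Rats_of_nat Rats_number_of Rats_1)
  ultimately show ?thesis by (simp add: pos_rat_def)
qed

text \<open>A rational square root of an integer is an integer, but this number lies strictly
  between the squares of m^2 - 1 and m^2.\<close>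

lemma no_rational_root:
  assumes m: "2 \<le> m" and q: "q \<in> \<rat>"
  shows "q\<^sup>2 \<noteq> (of_nat (m\<^sup>2 * (m\<^sup>2 - 1)) :: complex)"
proof
  define N where "N = m\<^sup>2 * (m\<^sup>2 - 1)"
  assume "q\<^sup>2 = (of_nat (m\<^sup>2 * (m\<^sup>2 - 1)) :: complex)"
  then have eq: "q\<^sup>2 = of_nat N" by (simp only: N_def)
  have "algebraic_int (q\<^sup>2)" unfolding eq by (intro int_imp_algebraic_int Ints_of_nat)
  then have "algebraic_int q"
    by (rule algebraic_int_root[of _ "monom 1 2"]) (simp_all add: poly_monom degree_monom_eq)
  then have "q \<in> \<int>" using q by (rule rational_algebraic_int_is_int)
  then obtain z where z: "q = of_int z" by (rule Ints_cases)
  have "(of_int (z\<^sup>2) :: complex) = of_int (int N)" using eq by (simp add: z)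
  then have "z\<^sup>2 = int N" by (simp only: of_int_eq_iff)
  then have "int ((nat \<bar>z\<bar>)\<^sup>2) = int N" by simp
  then have N: "(nat \<bar>z\<bar>)\<^sup>2 = N" by (simp only: of_nat_eq_iff)
  have "2\<^sup>2 \<le> m\<^sup>2" using m by (intro power_mono) auto
  then obtain t where t: "m\<^sup>2 = Suc t" "0 < t" by (cases "m\<^sup>2") auto
  have "N = Suc t * t" by (simp add: N_def t(1))
  then have "t\<^sup>2 < N" "N < (Suc t)\<^sup>2" using t(2) by (simp_all add: power2_eq_square)
  then have "t < nat \<bar>z\<bar>" "nat \<bar>z\<bar> < Suc t"
    unfolding N[symmetric] using power_less_imp_less_base by blast+
  then show False by simp
qed

text \<open>
  The two disjuncts say that \<open>q / p\<close> has residue \<open>r\<close> at a simple root \<open>x\<close> of \<open>p\<close>, respectively at a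
  double root \<open>x\<close> of \<open>p\<close> that is also a root of \<open>q\<close>.
\<close>
definition is_residue :: "complex poly \<Rightarrow> complex poly \<Rightarrow> complex \<Rightarrow> complex \<Rightarrow> bool" where
  "is_residue p q x r \<longleftrightarrow>
      (poly (pderiv p) x \<noteq> 0 \<and> poly q x = r * poly (pderiv p) x) \<or>
      (poly (pderiv p) x = 0 \<and> poly q x = 0 \<and> poly (pderiv (pderiv p)) x \<noteq> 0 \<and>
        2 * poly (pderiv q) x = r * poly (pderiv (pderiv p)) x)"

lemma weight_le_continuant_factor:
  assumes PQR: "continuant l l = Q * R" and l: "1 \<le> l"
  shows "weight_le Q (degree (vcoeff 0 Q))"
proof (rule weight_le_factor)
  show "weight_le (Q * R) (degree (vcoeff 0 (Q * R)))"
    unfolding PQR[symmetric] degree_vcoeff_0_continuant by (rule weight_le_continuant)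
  show "vcoeff 0 (Q * R) \<noteq> 0"
    unfolding PQR[symmetric] using degree_vcoeff_0_continuant[of l l] l by (metis degree_0 not_one_le_zero)
qed

text \<open>Powers of \<open>e\<close> are compared in the lowest coefficient of
  \<open>Q * R\<close> on the line. At a double root of P(u, 0), either \<open>R\<close> shares the
  root and each factor takes one branch, or \<open>Q\<close> carries both.\<close>

lemma residue_continuant_factor:
  assumes PQR: "continuant l l = Q * R" and l: "2 \<le> l"
    and root: "poly (vcoeff 0 Q) (wt l k) = 0" and k: "2 * k + 2 \<le> l"
  shows "\<exists>r. is_residue (vcoeff 0 Q) (vcoeff 1 Q) (wt l k) r \<and>
    (pos_rat r \<or> l = 2 * k + 2 \<and> r \<notin> \<rat>)"
proof -
  define x where "x = wt l k"
  let ?q = "\<lambda>e. poly Q [:x, e:]" and ?r = "\<lambda>e. poly R [:x, e:]"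
  define q0' q1 r0' r1 R0 where
    "q0' = poly (pderiv (vcoeff 0 Q)) x" and "q1 = poly (vcoeff 1 Q) x" and
    "r0' = poly (pderiv (vcoeff 0 R)) x" and "r1 = poly (vcoeff 1 R) x" and
    "R0 = poly (vcoeff 0 R) x"
  define q0'' q1' q2 where "q0'' = poly (pderiv (pderiv (vcoeff 0 Q))) x" and
    "q1' = poly (pderiv (vcoeff 1 Q)) x" and "q2 = poly (vcoeff 2 Q) x"
  have Q: "coeff (?q e) 0 = 0" "coeff (?q e) 1 = e * q0' + q1"
    "2 * coeff (?q e) 2 = e\<^sup>2 * q0'' + 2 * e * q1' + 2 * q2" for e
    using root by (simp_all add: coeff_line[simplified] q0'_def q1_def q0''_def q1'_def q2_def x_def)
  have R: "coeff (?r e) 0 = R0" "coeff (?r e) 1 = e * r0' + r1" for e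
    by (simp_all add: coeff_line[simplified] r0'_def r1_def R0_def)
  have lc: "line_coeff l x e i l = coeff (?q e * ?r e) i" for e i
    by (simp add: line_coeff_def PQR)
  have lc1: "line_coeff l x e 1 l = (e * q0' + q1) * R0" for e
    unfolding lc coeff_mult_012 by (simp add: Q(1) Q(2)[simplified] R(1) R(2)[simplified])
  have lc2: "2 * line_coeff l x e 2 l = 2 * ((e * q0' + q1) * (e * r0' + r1)) +
     (e\<^sup>2 * q0'' + 2 * e * q1' + 2 * q2) * R0" for e
  proof -
    have "2 * line_coeff l x e 2 l =
        2 * (coeff (?q e) 1 * coeff (?r e) 1) + (2 * coeff (?q e) 2) * coeff (?r e) 0"
      unfolding lc coeff_mult_012 Q(1) by (simp add: algebra_simps)
    then show ?thesis unfolding Q R .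
  qed
  have res: "is_residue (vcoeff 0 Q) (vcoeff 1 Q) (wt l k) r \<longleftrightarrow>
    (q0' \<noteq> 0 \<and> q1 = r * q0') \<or> (q0' = 0 \<and> q1 = 0 \<and> q0'' \<noteq> 0 \<and> 2 * q1' = r * q0'')" for r
    by (simp add: is_residue_def q0'_def q1_def q0''_def q1'_def x_def)
  show ?thesis
  proof (cases "k = 0")
    case True
    then have "x = 0" by (simp add: x_def)
    obtain C where C: "C \<noteq> 0" "\<And>e. line_coeff l 0 e 1 l = C * (e + 1)"
      using line_coeff_origin[OF l] by blast
    have "e * (q0' * R0) + q1 * R0 = e * C + C" for e
      using lc1[of e] C(2)[of e] \<open>x = 0\<close> by (simp add: algebra_simps)
    from affine_eq_iff[of "q0' * R0" "q1 * R0" C C, OF this]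
    have "q0' * R0 = C" "q1 * R0 = C" .
    then have "q0' \<noteq> 0 \<and> q1 = 1 * q0'" using C(1) by (metis mult_cancel_right mult_eq_0_iff mult_1)
    then show ?thesis unfolding res by (intro exI[of _ 1]) (simp add: pos_rat_def)
  next
    case False
    then have k1: "1 \<le> k" by simp
    define s where "s = shift l k"
    define D where "D = (if l = 2 * k + 2 then wt l k * wt l (Suc k) else 0)"
    obtain C where C: "C \<noteq> 0" "\<And>e. line_coeff l x e 2 l = C * ((e - s)\<^sup>2 - D)"
      using line_coeff_pair(3)[OF k1 k] unfolding x_def s_def D_def by blast
    have lc1z: "(e * q0' + q1) * R0 = 0" for e
      using line_coeff_pair(2)[OF k1 k, of e] lc1[of e] by (simp add: x_def)
    show ?thesis
    proof (cases "R0 = 0")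
      case True
      have e2: "(e * q0' + q1) * (e * r0' + r1) = C * ((e - s)\<^sup>2 - D)" for e
      proof -
        have "2 * ((e * q0' + q1) * (e * r0' + r1)) = 2 * (C * ((e - s)\<^sup>2 - D))"
          using lc2[of e] unfolding True C(2) by (simp only: mult_zero_right add_0_right)
        then show ?thesis by (simp only: mult_cancel_left zero_neq_numeral[symmetric] simp_thms)
      qed
      have "e\<^sup>2 * (q0' * r0') + e * (q0' * r1 + q1 * r0') + q1 * r1
         = e\<^sup>2 * C + e * (- 2 * C * s) + C * (s\<^sup>2 - D)" for e
        using e2[of e] by (simp add: algebra_simps power2_eq_square)
      from quadratic_eq_iff(1)[OF this] have "q0' \<noteq> 0" using C(1) by auto
      define r where "r = q1 / q0'"
      \<comment> \<open>The choice \<open>e = - r\<close> annihilates the linear coefficient of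
        \<open>Q\<close>, so \<open>- r\<close> is one of the two displacements.\<close>
      have "C * ((- r - s)\<^sup>2 - D) = 0" using e2[of "- r"] \<open>q0' \<noteq> 0\<close> by (simp add: r_def)
      then have rs: "(- r - s)\<^sup>2 = D" using C(1) by simp
      have "pos_rat r \<or> l = 2 * k + 2 \<and> r \<notin> \<rat>"
      proof (cases "l = 2 * k + 2")
        case True
        \<comment> \<open>The product a_k a_(k+1) has the form in \<open>no_rational_root\<close>
          with m = k + 1.\<close>
        have "D = of_nat ((Suc k)\<^sup>2 * ((Suc k)\<^sup>2 - 1))"
          unfolding D_def True by (simp add: wt_def power2_eq_square algebra_simps)
        then have "- r - s \<notin> \<rat>" using no_rational_root[of "Suc k" "- r - s"] k1 rs by auto
        moreover have "s \<in> \<rat>" using pos_rat_shift[OF k] by (simp add: s_def pos_rat_def)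
        ultimately have "r \<notin> \<rat>" using Rats_diff[of "- r" s] by auto
        then show ?thesis using True by simp
      next
        case False
        then have "- r - s = 0" using rs by (simp add: D_def)
        then have "r = - s" by (metis add.inverse_inverse right_minus_eq)
        then show ?thesis using pos_rat_shift[OF k] by (simp add: s_def)
      qed
      then show ?thesis unfolding res using \<open>q0' \<noteq> 0\<close> by (intro exI[of _ r]) (simp add: r_def)
    next
      case False
      \<comment> \<open>\<open>R\<close> does not vanish at \<open>x\<close>, so \<open>x\<close> is
        a double root of \<open>Q\<close>. The displacements add up to \<open>2 * s\<close>: the
        square roots cancel, even if \<open>l = 2 * k + 2\<close>.\<close>
      have "e * q0' + q1 = e * 0 + 0" for e using lc1z[of e] False by simp
      from affine_eq_iff[OF this] have z: "q0' = 0" "q1 = 0" .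
      have "e\<^sup>2 * (q0'' * R0) + e * (2 * q1' * R0) + 2 * q2 * R0
         = e\<^sup>2 * (2 * C) + e * (2 * (- 2 * C * s)) + 2 * (C * (s\<^sup>2 - D))" for e
      proof -
        have "e\<^sup>2 * (q0'' * R0) + e * (2 * q1' * R0) + 2 * q2 * R0
          = (e\<^sup>2 * q0'' + 2 * e * q1' + 2 * q2) * R0" by (simp add: algebra_simps)
        also have "\<dots> = 2 * (C * ((e - s)\<^sup>2 - D))"
          using lc2[of e] unfolding C(2) z by (simp only: mult_zero_left mult_zero_right add_0_left)
        also have "\<dots> = e\<^sup>2 * (2 * C) + e * (2 * (- 2 * C * s)) + 2 * (C * (s\<^sup>2 - D))"
          by (simp add: algebra_simps power2_eq_square)
        finally show ?thesis .
      qed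
      from quadratic_eq_iff(1,2)[OF this]
      have 1: "q0'' * R0 = 2 * C" "2 * q1' * R0 = 2 * (- 2 * C * s)" .
      have "2 * q1' * R0 = - 2 * s * (2 * C)" unfolding 1(2) by simp
      also have "\<dots> = (- 2 * s * q0'') * R0" unfolding 1(1)[symmetric] by simp
      finally have "2 * q1' = - 2 * s * q0''" using False by (simp only: mult_cancel_right simp_thms)
      moreover have "q0'' \<noteq> 0" using 1(1) C(1) by auto
      moreover have "pos_rat (- 2 * s)"
      proof -
        have "pos_rat (- s)" unfolding s_def by (rule pos_rat_shift[OF k])
        then have "pos_rat (- s + - s)" unfolding pos_rat_def by (intro conjI Rats_add) auto
        then show ?thesis by simp
      qed
      ultimately show ?thesis unfolding res by (intro exI[of _ "- 2 * s"]) (simp only: z simp_thms)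
    qed
  qed
qed

section \<open>Irreducibility\<close>

text \<open>Without the top root, at most one residue would be irrational and all others positive
  rationals, so they could not add up to 0.\<close>

lemma continuant_factor_top_root:
  assumes PQR: "continuant l l = Q * R" and l: "2 \<le> l" and deg: "0 < degree (vcoeff 0 Q)"
  shows "poly (vcoeff 0 Q) (wt l (l div 2)) = 0"
proof (rule ccontr)
  assume top: "poly (vcoeff 0 Q) (wt l (l div 2)) \<noteq> 0"
  let ?p = "vcoeff 0 Q" and ?q = "vcoeff 1 Q"
  let ?Z = "{x. poly ?p x = 0}"
  have P0: "vcoeff 0 (continuant l l) = ?p * vcoeff 0 R" by (simp add: PQR vcoeff_0_mult)
  have root: "\<exists>k. x = wt l k \<and> 2 * k + 2 \<le> l" if "poly ?p x = 0" for x
  proof -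
    have "poly (vcoeff 0 (continuant l l)) x = 0" unfolding P0 using that by simp
    then obtain i where i: "i < l" "x = wt l i" by (auto simp: vcoeff_0_continuant poly_prod)
    \<comment> \<open>The smaller of \<open>i\<close> and \<open>l - i\<close>; excluding the top
      value then gives \<open>2 * k + 2 \<le> l\<close>.\<close>
    define k where "k = (if 2 * i \<le> l then i else l - i)"
    have k: "x = wt l k" "2 * k \<le> l" using i wt_diff[of i l] by (auto simp: k_def)
    have "k \<noteq> l div 2" using that top k by auto
    with k show ?thesis by (intro exI[of _ k]) presburger
  qed
  \<comment> \<open>For even \<open>l\<close>, the value at k = l/2 - 1, the only one whose residue
    may be irrational.\<close>
  define bad where "bad = wt l (l div 2 - 1)"
  have "\<exists>r. is_residue ?p ?q x r \<and> (pos_rat r \<or> x = bad \<and> r \<notin> \<rat>)" if "poly ?p x = 0" for x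
  proof -
    obtain k where k: "x = wt l k" "2 * k + 2 \<le> l" using root \<open>poly ?p x = 0\<close> by blast
    have "l = 2 * k + 2 \<Longrightarrow> wt l k = bad" by (simp add: bad_def)
    with residue_continuant_factor[OF PQR l _ k(2)] that show ?thesis unfolding k(1) by blast
  qed
  then obtain r where r: "\<And>x. poly ?p x = 0 \<Longrightarrow> is_residue ?p ?q x (r x)"
    "\<And>x. poly ?p x = 0 \<Longrightarrow> pos_rat (r x) \<or> x = bad \<and> r x \<notin> \<rat>" by metis
  have "weight_le Q (degree ?p)"
    using PQR l by (intro weight_le_continuant_factor) auto
  then have small: "coeff ?q j = 0" if "degree ?p \<le> Suc j" for j
    using that weight_le_coeff_1 by blast
  have sum0: "(\<Sum>x\<in>?Z. r x) = 0"
    by (rule sum_residues_eq_0[OF small deg]) (use r(1) in \<open>simp_all only: is_residue_def\<close>)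
  have fin: "finite ?Z" using deg by (intro poly_roots_finite) auto
  have ne: "?Z \<noteq> {}"
    using deg fundamental_theorem_of_algebra constant_degree by (metis (mono_tags) empty_Collect_eq less_not_refl)
  show False
  proof (cases "bad \<in> ?Z \<and> r bad \<notin> \<rat>")
    case True
    have "(\<Sum>x\<in>?Z. r x) = r bad + (\<Sum>x\<in>?Z - {bad}. r x)"
      using fin True by (intro sum.remove) auto
    moreover have "(\<Sum>x\<in>?Z - {bad}. r x) \<in> \<rat>"
      using r(2) by (intro Rats_sum) (auto simp: pos_rat_def)
    moreover have "r bad = - (\<Sum>x\<in>?Z - {bad}. r x)"
      using sum0 calculation(1) by (simp only: eq_neg_iff_add_eq_0)
    ultimately have "r bad \<in> \<rat>" by simp
    then show False using True by simp
  next
    case False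
    then have "\<And>x. x \<in> ?Z \<Longrightarrow> 0 < Re (r x)" using r(2) by (auto simp: pos_rat_def)
    then have "0 < (\<Sum>x\<in>?Z. Re (r x))" using fin ne by (intro sum_pos) auto
    then have "0 < Re (\<Sum>x\<in>?Z. r x)" by simp
    then show False using sum0 by simp
  qed
qed

lemma irreducible_continuant:
  assumes "1 \<le> l"
  shows "irreducible (continuant l l)"
proof (rule irreducibleI)
  have deg: "degree (vcoeff 0 (continuant l l)) = l" by (rule degree_vcoeff_0_continuant)
  show "continuant l l \<noteq> 0" using deg assms by auto
  show "\<not> continuant l l dvd 1"
  proof
    assume "continuant l l dvd 1"
    then obtain c where "continuant l l = [:c:]" by (auto simp: is_unit_poly_iff)
    then show False using deg assms by simp
  qed
  fix Q R assume PQR: "continuant l l = Q * R"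
  have nz: "vcoeff 0 (Q * R) \<noteq> 0" using deg assms unfolding PQR by auto
  have wQ: "weight_le Q (degree (vcoeff 0 Q))" and wR: "weight_le R (degree (vcoeff 0 R))"
    using weight_le_continuant_factor[OF PQR assms] weight_le_continuant_factor[of l R Q] PQR assms
    by (simp_all add: mult.commute)
  \<comment> \<open>A factor whose part at \<open>v = 0\<close> is constant has weight 0 and is
    therefore a constant.\<close>
  have unit: "S dvd 1" if "weight_le S (degree (vcoeff 0 S))" "degree (vcoeff 0 S) = 0" "S \<noteq> 0" for S
  proof -
    define c where "c = coeff (coeff S 0) 0"
    have c: "S = [:[:c:]:]" unfolding c_def by (rule weight_le_0_const) (use that in simp)
    then have "c \<noteq> 0" using that by auto
    then show ?thesis unfolding c is_unit_const_poly_iff by (simp add: dvd_field_iff)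
  qed
  have "degree (vcoeff 0 Q) = 0 \<or> degree (vcoeff 0 R) = 0"
  proof (rule ccontr)
    assume "\<not> ?thesis"
    then have pos: "0 < degree (vcoeff 0 Q)" "0 < degree (vcoeff 0 R)" by auto
    have "degree (vcoeff 0 Q) + degree (vcoeff 0 R) = l"
      using deg nz unfolding PQR vcoeff_0_mult by (subst (asm) degree_mult_eq) auto
    with pos have l: "2 \<le> l" by linarith
    define x where "x = wt l (l div 2)"
    have x: "poly (vcoeff 0 Q) x = 0" "poly (vcoeff 0 R) x = 0"
      unfolding x_def
      using continuant_factor_top_root[of l Q R] continuant_factor_top_root[of l R Q] PQR l pos
      by (simp_all add: mult.commute)
    \<comment> \<open>Both factors vanish at (x, 0), so their product has no linear term on any line
      through this point.\<close>
    have "line_coeff l x e 1 l = 0" for e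
      unfolding line_coeff_def PQR poly_mult coeff_mult_012 by (simp add: coeff_line x)
    then show False using line_coeff_top[OF l] by (simp add: x_def)
  qed
  moreover have "Q \<noteq> 0" "R \<noteq> 0" using nz by auto
  ultimately show "Q dvd 1 \<or> R dvd 1" using unit[OF wQ] unit[OF wR] by auto
qed

theorem theorem1p2:
  fixes l :: nat
  assumes "l \<ge> 1"
  shows "(\<exists>P. is_P l P) \<and> (\<forall>P. is_P l P \<longrightarrow> irreducible P)"
  using is_P_continuant is_P_unique irreducible_continuant[OF assms] by blast

end
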